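(* There is a $2$-ball-box distribution that does not admit a $6$-term box progression ($6$-BP).
   Context: For an integer $\ell\ge 2$, an $\ell$-ball-box distribution is a surjection $\mathcal{D}:\mathbb{Z}_{>0}\to\mathbb{Z}_{>0}$ (where $\mathcal{D}(i)$ is the label of the box containing ball $i$) such that for every $i\in\mathbb{Z}_{>0}$ the fibre $\mathcal{D}^{-1}(i)$ is non-empty and has at most $\ell$ elements, and $\mathcal{D}(i)\le\mathcal{D}(i+1)$ for all $i$. Given such $\mathcal{D}$, a $k$-term box progression ($k$-BP) is a sequence of positive integers $h_1,\dots,h_k$ which is a non-trivial $k$-term arithmetic progression (common difference $\neq 0$) and such that $\mathcal{D}(h_1),\dots,\mathcal{D}(h_k)$ is a $k$-term arithmetic progression (possibly trivial, i.e. with common difference $0$). *)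

theory Defs
  imports Main
begin

(* Balls and boxes are labelled by the positive integers, encoded as {0<..} :: nat set; the value
   D 0 is never constrained or used.  Finiteness of the fibres is stated separately because card
   is 0 on infinite sets. *)
definition ball_box_distribution :: "nat \<Rightarrow> (nat \<Rightarrow> nat) \<Rightarrow> bool" where
  "ball_box_distribution l D \<longleftrightarrow>
     2 \<le> l \<and>
     D ` {0<..} = {0<..} \<and>
     (\<forall>i>0. {b. 0 < b \<and> D b = i} \<noteq> {} \<and>
            finite {b. 0 < b \<and> D b = i} \<and>
            card {b. 0 < b \<and> D b = i} \<le> l) \<and>
     (\<forall>i>0. D i \<le> D (i + 1))"

(* The terms are s 1, ..., s k; values of s at other indices are irrelevant.  The difference is an
   integer, so decreasing progressions are included. *)
definition arith_prog :: "nat \<Rightarrow> (nat \<Rightarrow> nat) \<Rightarrow> int \<Rightarrow> bool" where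
  "arith_prog k s d \<longleftrightarrow> (\<forall>i\<in>{1..<k}. int (s (i + 1)) - int (s i) = d)"

definition box_progression :: "(nat \<Rightarrow> nat) \<Rightarrow> nat \<Rightarrow> (nat \<Rightarrow> nat) \<Rightarrow> bool" where
  "box_progression D k h \<longleftrightarrow>
     (\<forall>i\<in>{1..k}. 0 < h i) \<and>
     (\<exists>d. d \<noteq> 0 \<and> arith_prog k h d) \<and>
     (\<exists>e. arith_prog k (\<lambda>i. D (h i)) e)"

end

theory Submission
  imports Defs "HOL-Library.Sublist"
begin

text \<open>
  Put \<open>D i\<close> = 1 + the number of 1s among the first \<open>i - 1\<close> letters of a binary word \<open>w\<close>. If \<open>w\<close> has no
  factor 00, then every box holds at most two balls, and a 6-term box progression is the same as
  five consecutive factors of \<open>w\<close> with equally many 0s and equally many 1s. Such factors are avoided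
  by the fixed point of \<open>0 \<mapsto> 010101\<close>, \<open>1 \<mapsto> 01111\<close>: six prefixes with letter counts \<open>(x, y)\<close> in
  arithmetic progression can be pulled back through the substitution. A prefix is the image of a
  prefix with counts \<open>(v, v')\<close>, up to an error, so \<open>x = 3 v + v' + t\<close> and
  \<open>y = 3 v + 4 v' + t + e\<close> with \<open>0 \<le> t \<le> 2\<close> and \<open>\<bar>e\<bar> \<le> 1\<close>. Along a progression \<open>e\<close> is either constant or runs
  cyclically through all residues modulo 3. The latter fails because \<open>e = 1\<close> occurs at two places
  three terms apart and forces \<open>t = 1\<close>. The same dichotomy then holds for \<open>t\<close>, where \<open>t = 2\<close> occurs only
  in front of a letter 0, and at such places \<open>v' - v\<close> is divisible by 3. So \<open>t\<close> and \<open>e\<close> are constant and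
  \<open>(v, v')\<close> is again a progression.
\<close>

section \<open>The substitution and its iterates\<close>

primrec image_letter :: "bool \<Rightarrow> bool list" where
  "image_letter False = [False, True, False, True, False, True]"
| "image_letter True = [False, True, True, True, True]"

definition image_word :: "bool list \<Rightarrow> bool list" where
  "image_word u = concat (map image_letter u)"

definition iter_word :: "nat \<Rightarrow> bool list" where
  "iter_word k = (image_word ^^ k) [False]"

lemma image_word_simps [simp]:
  "image_word [] = []"
  "image_word (c # u) = image_letter c @ image_word u"
  "image_word (u @ v) = image_word u @ image_word v"
  by (simp_all add: image_word_def)

lemma iter_word_0 [simp]: "iter_word 0 = [False]"
  by (simp add: iter_word_def)

lemma iter_word_Suc: "iter_word (Suc k) = image_word (iter_word k)"
  by (simp add: iter_word_def)

lemma prefix_image_word: "prefix u v \<Longrightarrow> prefix (image_word u) (image_word v)"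
  by (auto simp: prefix_def)

text \<open>The image of 0 begins with 0 and images preserve prefixes, so the iterates form a chain
  whose limit is the infinite fixed point.\<close>

lemma prefix_iter_word_Suc: "prefix (iter_word k) (iter_word (Suc k))"
proof (induction k)
  case 0
  show ?case by (simp add: iter_word_Suc)
next
  case (Suc k)
  then show ?case by (metis iter_word_Suc prefix_image_word)
qed

lemma prefix_iter_word: "k \<le> l \<Longrightarrow> prefix (iter_word k) (iter_word l)"
  by (induction l rule: dec_induct) (auto intro: prefix_order.trans prefix_iter_word_Suc)

lemma length_image_word: "5 * length u \<le> length (image_word u)"
proof (induction u)
  case (Cons c u)
  then show ?case by (cases c) simp_all
qed simp

lemma length_iter_word: "k < length (iter_word k)"
proof (induction k)
  case (Suc k)
  then show ?case using length_image_word[of "iter_word k"] by (simp add: iter_word_Suc)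
qed simp

section \<open>Letter counts and prefixes of image words\<close>

lemma length_eq_count_list: "length p = count_list p False + count_list p True"
  by (induction p) auto

lemma count_image_word:
  "count_list (image_word u) False = 3 * count_list u False + count_list u True"
  "count_list (image_word u) True = 3 * count_list u False + 4 * count_list u True"
proof (induction u)
  case (Cons c u)
  case 1 then show ?case using Cons by (cases c) simp_all
  case 2 then show ?case using Cons by (cases c) simp_all
qed simp_all

text \<open>A prefix of the image cuts at most one block. The cut letter \<open>c\<close> is kept
  because later arguments round up to \<open>q @ [c]\<close> or need to know that a 0 follows
  \<open>q\<close>.\<close>

lemma prefix_image_word_cases:
  assumes "prefix p (image_word u)"
  obtains (whole) q where "prefix q u" "p = image_word q"
  | (partial) q c r where "prefix (q @ [c]) u" "strict_prefix r (image_letter c)"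
      "p = image_word q @ r"
proof -
  have "(\<exists>q. prefix q u \<and> p = image_word q) \<or>
    (\<exists>q c r. prefix (q @ [c]) u \<and> strict_prefix r (image_letter c) \<and> p = image_word q @ r)"
    using assms
  proof (induction u arbitrary: p)
    case (Cons c u)
    then consider "prefix p (image_letter c)"
      | p' where "p = image_letter c @ p'" "prefix p' (image_word u)"
      by (auto simp: prefix_append)
    then show ?case
    proof cases
      case 1
      show ?thesis
      proof (cases "p = image_letter c")
        case True
        then have "prefix [c] (c # u) \<and> p = image_word [c]" by simp
        then show ?thesis by blast
      next
        case False
        then have "prefix ([] @ [c]) (c # u) \<and> strict_prefix p (image_letter c) \<and> p = image_word [] @ p"
          using 1 by (auto simp: strict_prefix_def)
        then show ?thesis by blast
      qed
    next
      case 2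
      from Cons.IH[OF 2(2)] show ?thesis
      proof (elim disjE exE conjE)
        fix q assume "prefix q u" "p' = image_word q"
        then have "prefix (c # q) (c # u) \<and> p = image_word (c # q)" using 2 by simp
        then show ?thesis by blast
      next
        fix q d r assume "prefix (q @ [d]) u" "strict_prefix r (image_letter d)" "p' = image_word q @ r"
        then have "prefix ((c # q) @ [d]) (c # u) \<and> strict_prefix r (image_letter d)
            \<and> p = image_word (c # q) @ r"
          using 2 by simp
        then show ?thesis by blast
      qed
    qed
  qed simp
  then show ?thesis using that by blast
qed

lemma last_image_word: "u \<noteq> [] \<Longrightarrow> last (image_word u)"
proof (induction u rule: rev_induct)
  case (snoc c u)
  then show ?case by (cases c) simp_all
qed simp

lemma strict_prefix_image_letter_cases:
  assumes "strict_prefix r (image_letter c)"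
  shows "r = [] \<or> r = [False] \<or> r = [False, True] \<or>
    \<not> c \<and> (r = [False, True, False] \<or> r = [False, True, False, True]
          \<or> r = [False, True, False, True, False]) \<or>
    c \<and> (r = [False, True, True] \<or> r = [False, True, True, True])"
  using assms by (cases c) (auto simp: strict_prefix_def prefix_Cons)

definition prefix_counts :: "bool list \<Rightarrow> int \<Rightarrow> int \<Rightarrow> bool" where
  "prefix_counts u x y \<longleftrightarrow>
    (\<exists>p. prefix p u \<and> x = int (count_list p False) \<and> y = int (count_list p True))"

definition prefix_counts_before_0 :: "bool list \<Rightarrow> int \<Rightarrow> int \<Rightarrow> bool" where
  "prefix_counts_before_0 u x y \<longleftrightarrow>
    (\<exists>p. prefix (p @ [False]) u \<and> x = int (count_list p False) \<and> y = int (count_list p True))"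

text \<open>Inside a block, a 0 is preceded only by the empty word, 01 or 0101, which are balanced,
  and whole blocks contribute to \<open>y - x\<close> three times the number of 1s in
  \<open>q\<close>.\<close>

lemma prefix_counts_before_0_image_word:
  assumes "prefix_counts_before_0 (image_word u) x y"
  shows "3 dvd y - x"
proof -
  obtain p where p: "prefix (p @ [False]) (image_word u)"
    "x = int (count_list p False)" "y = int (count_list p True)"
    using assms by (auto simp: prefix_counts_before_0_def)
  from p(1) show ?thesis
  proof (cases rule: prefix_image_word_cases)
    case (whole q)
    then have "q \<noteq> []" by auto
    \<comment> \<open>Both blocks end in 1, so a prefix ending in 0 cannot stop at a block
      boundary.\<close>
    from last_image_word[OF this] whole show ?thesis by (metis last_snoc)
  next
    case (partial q c r)
    have nz: "r \<noteq> []"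
    proof
      assume "r = []"
      then have "image_word q = p @ [False]" using partial by simp
      moreover from this have "q \<noteq> []" by auto
      ultimately show False using last_image_word[of q] by simp
    qed
    then have r: "\<not> last r" "p = image_word q @ butlast r"
      using partial(3) by (metis last_appendR last_snoc, metis butlast_append butlast_snoc)
    from strict_prefix_image_letter_cases[OF partial(2)] nz r(1)
    have "r = [False] \<or> r = [False, True, False] \<or> r = [False, True, False, True, False]"
      by auto
    then have "y - x = 3 * int (count_list q True)"
      using r(2) p(2,3) by (auto simp: count_image_word)
    then show ?thesis by simp
  qed
qed

text \<open>Rounding to a nearby block boundary keeps \<open>t\<close> and \<open>e\<close> in
  ranges of three consecutive values, so that each is determined by its residue modulo 3.\<close>

lemma prefix_counts_image_word:
  assumes "prefix_counts (image_word u) x y"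
  shows "\<exists>v v' t e. prefix_counts u v v' \<and> x = 3 * v + v' + t \<and> y = 3 * v + 4 * v' + t + e \<and>
    0 \<le> t \<and> t \<le> 2 \<and> -1 \<le> e \<and> e \<le> 1 \<and> (e = 1 \<longrightarrow> t = 1) \<and>
    (t = 2 \<longrightarrow> prefix_counts_before_0 u v v')"
    (is "\<exists>v v' t e. ?P v v' t e")
proof -
  obtain p where p: "prefix p (image_word u)"
    "x = int (count_list p False)" "y = int (count_list p True)"
    using assms by (auto simp: prefix_counts_def)
  from p(1) show ?thesis
  proof (cases rule: prefix_image_word_cases)
    case (whole q)
    then have "?P (int (count_list q False)) (int (count_list q True)) 0 0"
      using p by (auto simp: count_image_word prefix_counts_def)
    then show ?thesis by blast
  next
    case (partial q c r)
    define v v' where "v = int (count_list q False)" and "v' = int (count_list q True)"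
    have here: "prefix_counts u v v'"
      using append_prefixD[OF partial(1)] by (auto simp: prefix_counts_def v_def v'_def)
    have zero: "prefix_counts_before_0 u v v'" if "\<not> c"
      using partial(1) that by (auto simp: prefix_counts_before_0_def v_def v'_def)
    \<comment> \<open>Needed for the remainders 01010 and 0111, where rounding down would give
      \<open>t = 3\<close> and \<open>e = 2\<close>, respectively.\<close>
    have after: "prefix_counts u (v + of_bool (\<not> c)) (v' + of_bool c)"
      unfolding prefix_counts_def
      using partial(1) by (intro exI[of _ "q @ [c]"]) (auto simp: v_def v'_def)
    have xy: "x = 3 * v + v' + int (count_list r False)" "y = 3 * v + 4 * v' + int (count_list r True)"
      using p(2,3) partial(3) by (simp_all add: count_image_word v_def v'_def)
    from strict_prefix_image_letter_cases[OF partial(2)]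
    consider "r = []" | "r = [False]" | "r = [False, True]"
      | "\<not> c" "r = [False, True, False]" | "\<not> c" "r = [False, True, False, True]"
      | "\<not> c" "r = [False, True, False, True, False]"
      | "c" "r = [False, True, True]" | "c" "r = [False, True, True, True]"
      by blast
    then show ?thesis
    proof cases
      case 1
      then have "?P v v' 0 0" using here xy by simp
      then show ?thesis by blast
    next
      case 2
      then have "?P v v' 1 (-1)" using here xy by simp
      then show ?thesis by blast
    next
      case 3
      then have "?P v v' 1 0" using here xy by simp
      then show ?thesis by blast
    next
      case 4
      then have "?P v v' 2 (-1)" using here xy zero by simp
      then show ?thesis by blast
    next
      case 5
      then have "?P v v' 2 0" using here xy zero by simp
      then show ?thesis by blast
    next
      case 6
      then have "?P (v + 1) v' 0 (-1)" using after xy by simp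
      then show ?thesis by blast
    next
      case 7
      then have "?P v v' 1 1" using here xy by simp
      then show ?thesis by blast
    next
      case 8
      then have "?P v (v' + 1) 0 (-1)" using after xy by simp
      then show ?thesis by blast
    qed
  qed
qed

section \<open>Pulling progressions back through the substitution\<close>

definition no_count_progression :: "bool list \<Rightarrow> bool" where
  "no_count_progression u \<longleftrightarrow>
    (\<forall>x y a b. (\<forall>j\<in>{0..5}. prefix_counts u (x + j * a) (y + j * b)) \<longrightarrow> a = 0 \<and> b = 0)"

text \<open>Three consecutive terms already meet every residue. Keeping \<open>j\<close> at most 2
  leaves \<open>j + 3\<close> among the six terms.\<close>

lemma residue_mod_3_attained:
  fixes m g :: int
  assumes "\<not> 3 dvd g"
  obtains j where "j \<in> {0..2}" "(m + j * g) mod 3 = c mod 3"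
proof -
  have "3 dvd d \<or> 3 dvd d + g \<or> 3 dvd d + 2 * g" for d
    using assms by presburger
  from this[of "m - c"] show ?thesis
    using that[of 0] that[of 1] that[of 2] by (auto simp: mod_eq_dvd_iff algebra_simps)
qed

text \<open>The residue of \<open>s j\<close> modulo 3 does not depend on \<open>j\<close>, and the
  range of three values turns equal residues into equality.\<close>

lemma bounded_residue_eq:
  fixes V s :: "int \<Rightarrow> int" and g m l :: int
  assumes "\<And>j. j \<in> {0..5} \<Longrightarrow> m + j * g = 3 * V j + s j" "3 dvd g"
    and "\<And>j. j \<in> {0..5} \<Longrightarrow> l \<le> s j \<and> s j \<le> l + 2" "j \<in> {0..5::int}"
  shows "s j = s 0" "V j = V 0 + j * (g div 3)"
proof -
  obtain h where h: "g = 3 * h" using assms(2) by blast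
  have *: "m + 3 * (j * h) = 3 * V j + s j" "m = 3 * V 0 + s 0"
    using assms(1)[OF assms(4)] assms(1)[of 0] by (simp_all add: h algebra_simps)
  have b: "l \<le> s j \<and> s j \<le> l + 2" "l \<le> s 0 \<and> s 0 \<le> l + 2"
    using assms(3)[OF assms(4)] assms(3)[of 0] by auto
  show "s j = s 0" using * b by presburger
  then show "V j = V 0 + j * (g div 3)" using * h by simp
qed

text \<open>Descent from the image to \<open>u\<close>. The condition \<open>zero\<close> concerns
  \<open>u\<close> itself and can fail for arbitrary words, for instance for 10.\<close>

lemma no_count_progression_image_word:
  assumes "no_count_progression u"
    and zero: "\<And>v v'. prefix_counts_before_0 u v v' \<Longrightarrow> 3 dvd v' - v"
  shows "no_count_progression (image_word u)"
  unfolding no_count_progression_def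
proof (intro allI impI)
  fix x y a b :: int
  assume "\<forall>j\<in>{0..5}. prefix_counts (image_word u) (x + j * a) (y + j * b)"
  then have "\<forall>j\<in>{0..5}. \<exists>v v' t e. prefix_counts u v v' \<and> x + j * a = 3 * v + v' + t \<and>
    y + j * b = 3 * v + 4 * v' + t + e \<and> 0 \<le> t \<and> t \<le> 2 \<and> -1 \<le> e \<and> e \<le> 1 \<and> (e = 1 \<longrightarrow> t = 1) \<and>
    (t = 2 \<longrightarrow> prefix_counts_before_0 u v v')"
    using prefix_counts_image_word by blast
  then obtain v v' t e where all: "\<forall>j\<in>{0..5}. prefix_counts u (v j) (v' j) \<and>
      x + j * a = 3 * v j + v' j + t j \<and> y + j * b = 3 * v j + 4 * v' j + t j + e j \<and>
      0 \<le> t j \<and> t j \<le> 2 \<and> -1 \<le> e j \<and> e j \<le> 1 \<and> (e j = 1 \<longrightarrow> t j = 1) \<and>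
      (t j = 2 \<longrightarrow> prefix_counts_before_0 u (v j) (v' j))"
    unfolding bchoice_iff by (elim exE) (rule that)
  have pull: "prefix_counts u (v j) (v' j)"
      "x + j * a = 3 * v j + v' j + t j" "y + j * b = 3 * v j + 4 * v' j + t j + e j"
      "0 \<le> t j \<and> t j \<le> 2" "-1 \<le> e j \<and> e j \<le> 1" "e j = 1 \<longrightarrow> t j = 1"
      "t j = 2 \<longrightarrow> prefix_counts_before_0 u (v j) (v' j)"
    if "j \<in> {0..5}" for j
    using bspec[OF all that] by blast+
  define m n where "m = y - x" and "n = b - a"
  \<comment> \<open>Taking \<open>y - x\<close> cancels \<open>v j\<close> and
    \<open>t j\<close>.\<close>
  have diff: "m + j * n = 3 * v' j + e j" if "j \<in> {0..5}" for j
    using pull(2,3)[OF that] by (simp add: m_def n_def algebra_simps)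
  have n3: "3 dvd n"
  proof (rule ccontr)
    assume "\<not> 3 dvd n"
    \<comment> \<open>Residue 1 forces \<open>e j = 1\<close>, and \<open>j + 3\<close> has the same
      residue.\<close>
    then obtain j where j: "j \<in> {0..2}" "(m + j * n) mod 3 = 1 mod 3"
      by (rule residue_mod_3_attained)
    then have in5: "j \<in> {0..5}" "j + 3 \<in> {0..5}" by auto
    have "e j = 1" using diff[OF in5(1)] pull(5)[OF in5(1)] j(2) by presburger
    moreover have "e (j + 3) = 1"
      using diff[OF in5(2)] pull(5)[OF in5(2)] j(2) by (simp add: algebra_simps) presburger
    ultimately have "3 * v' (j + 3) - 3 * v' j = 3 * n"
      "3 * v (j + 3) + v' (j + 3) - 3 * v j - v' j = 3 * a"
      using diff[OF in5(1)] diff[OF in5(2)] pull(2,6)[OF in5(1)] pull(2,6)[OF in5(2)]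
      by (simp_all add: algebra_simps)
    \<comment> \<open>The first equation makes the increment of \<open>v'\<close> equal to
      \<open>n\<close>, the second makes it a multiple of 3.\<close>
    then show False using \<open>\<not> 3 dvd n\<close> by presburger
  qed
  define n' where "n' = n div 3"
  have v': "v' j = v' 0 + j * n'" and e: "e j = e 0" if "j \<in> {0..5}" for j
    using bounded_residue_eq[of m n v' e "-1" j] diff n3 pull(5) that by (auto simp: n'_def)
  \<comment> \<open>With \<open>v'\<close> now linear in \<open>j\<close>, the equation for
    \<open>x\<close> has the same shape for \<open>v\<close> and \<open>t\<close>.\<close>
  define g where "g = a - n'"
  have sum: "(x - v' 0) + j * g = 3 * v j + t j" if "j \<in> {0..5}" for j
    using pull(2)[OF that] v'[OF that] by (simp add: g_def algebra_simps)
  have g3: "3 dvd g"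
  proof (rule ccontr)
    assume "\<not> 3 dvd g"
    then obtain j where j: "j \<in> {0..2}" "(x - v' 0 + j * g) mod 3 = 2 mod 3"
      by (rule residue_mod_3_attained)
    then have in5: "j \<in> {0..5}" "j + 3 \<in> {0..5}" by auto
    have t: "t j = 2" using sum[OF in5(1)] pull(4)[OF in5(1)] j(2) by presburger
    have t': "t (j + 3) = 2"
      using sum[OF in5(2)] pull(4)[OF in5(2)] j(2) by (simp add: algebra_simps) presburger
    have "3 dvd v' j - v j" "3 dvd v' (j + 3) - v (j + 3)"
      using zero pull(7) in5 t t' by blast+
    moreover have "v' (j + 3) - v' j = 3 * n'"
      using v'[OF in5(1)] v'[OF in5(2)] by (simp add: algebra_simps)
    moreover have "3 * v (j + 3) - 3 * v j = 3 * g"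
      using sum[OF in5(1)] sum[OF in5(2)] t t' by (simp add: algebra_simps)
    \<comment> \<open>Between the two places \<open>v' - v\<close> grows by
      \<open>3 * n' - g\<close>, which must be a multiple of 3.\<close>
    ultimately show False using \<open>\<not> 3 dvd g\<close> by presburger
  qed
  have v: "v j = v 0 + j * (g div 3)" if "j \<in> {0..5}" for j
    using bounded_residue_eq[of "x - v' 0" g v t 0 j] sum g3 pull(4) that by auto
  have "\<forall>j\<in>{0..5}. prefix_counts u (v 0 + j * (g div 3)) (v' 0 + j * n')"
    using pull(1) v v' by metis
  then have "g div 3 = 0 \<and> n' = 0"
    using assms(1) unfolding no_count_progression_def by blast
  then have "g = 0" "n = 0" "n' = 0" using g3 n3 by (auto simp: n'_def)
  then show "a = 0 \<and> b = 0" by (simp add: g_def n_def)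
qed

lemma prefix_counts_before_0_iter_word:
  assumes "prefix_counts_before_0 (iter_word k) x y"
  shows "3 dvd y - x"
proof (cases k)
  case 0
  then show ?thesis using assms by (auto simp: prefix_counts_before_0_def prefix_Cons)
next
  case (Suc l)
  then show ?thesis using assms prefix_counts_before_0_image_word by (simp add: iter_word_Suc)
qed

lemma no_count_progression_iter_word: "no_count_progression (iter_word k)"
proof (induction k)
  case 0
  have *: "0 \<le> x \<and> x \<le> 1 \<and> y = 0" if "prefix_counts [False] x y" for x y
    using that by (auto simp: prefix_counts_def prefix_Cons)
  show ?case
    unfolding no_count_progression_def iter_word_0
  proof (intro allI impI)
    fix x y a b :: int
    assume "\<forall>j\<in>{0..5}. prefix_counts [False] (x + j * a) (y + j * b)"
    \<comment> \<open>The end terms suffice: \<open>5 * a\<close> lies between -1 and 1, and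
      \<open>5 * b\<close> is 0.\<close>
    then have "prefix_counts [False] (x + 0 * a) (y + 0 * b)"
      "prefix_counts [False] (x + 5 * a) (y + 5 * b)"
      by (rule bspec; simp)+
    from this[THEN *] show "a = 0 \<and> b = 0" by auto
  qed
next
  case (Suc k)
  then show ?case
    unfolding iter_word_Suc
    by (rule no_count_progression_image_word) (rule prefix_counts_before_0_iter_word)
qed

text \<open>The prefixes before two adjacent 0s have values of \<open>y - x\<close> that differ by
  1, yet both would be multiples of 3.\<close>

lemma no_double_False_image_word: "\<not> prefix (p @ [False, False]) (image_word u)"
proof
  assume pre: "prefix (p @ [False, False]) (image_word u)"
  have 1: "prefix_counts_before_0 (image_word u) (int (count_list p False)) (int (count_list p True))"
    using append_prefixD[of "p @ [False]" "[False]"] pre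
    by (auto simp: prefix_counts_before_0_def)
  have 2: "prefix_counts_before_0 (image_word u) (int (count_list p False) + 1) (int (count_list p True))"
    unfolding prefix_counts_before_0_def using pre by (intro exI[of _ "p @ [False]"]) auto
  from 1[THEN prefix_counts_before_0_image_word] 2[THEN prefix_counts_before_0_image_word]
  show False by presburger
qed

section \<open>The ball-box distribution\<close>

definition box :: "nat \<Rightarrow> nat" where
  "box i = Suc (count_list (take (i - 1) (iter_word i)) True)"

text \<open>Lets finite iterates stand in for the infinite word: \<open>iter_word i\<close> has more
  than \<open>i\<close> letters and is a prefix of all later iterates.\<close>

lemma take_iter_word_eq:
  assumes "i \<le> k" "i \<le> l"
  shows "take i (iter_word k) = take i (iter_word l)"
proof -
  have "take i (iter_word k) = take i (iter_word i)" if "i \<le> k" for k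
    using prefix_iter_word[OF that] length_iter_word[of i] by (auto simp: prefix_def)
  then show ?thesis using assms by metis
qed

lemma box_eq: "i \<le> Suc k \<Longrightarrow> box i = Suc (count_list (take (i - 1) (iter_word k)) True)"
  unfolding box_def using take_iter_word_eq[of "i - 1" i k] by simp

lemma box_1: "box 1 = 1"
  by (simp add: box_def)

lemma box_Suc:
  assumes "0 < i"
  shows "box (Suc i) = box i + of_bool (iter_word i ! (i - 1))"
proof -
  have "box (Suc i) = Suc (count_list (take (Suc (i - 1)) (iter_word i)) True)"
    using box_eq[of "Suc i" i] assms by simp
  also have "take (Suc (i - 1)) (iter_word i) = take (i - 1) (iter_word i) @ [iter_word i ! (i - 1)]"
    using length_iter_word[of i] by (intro take_Suc_conv_app_nth) simp
  finally show ?thesis by (simp add: box_def)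
qed

lemma box_Suc_Suc:
  assumes "0 < i"
  shows "box i < box (Suc (Suc i))"
proof (rule ccontr)
  assume "\<not> box i < box (Suc (Suc i))"
  then have f: "\<not> iter_word i ! (i - 1)" "\<not> iter_word (Suc i) ! i"
    using box_Suc[of i] box_Suc[of "Suc i"] assms by (auto split: if_splits)
  let ?w = "iter_word (Suc i)"
  have len: "Suc i < length ?w" by (rule length_iter_word)
  \<comment> \<open>The two letters come from different iterates; both are moved into
    \<open>?w\<close>, which is an image word.\<close>
  have "iter_word i ! (i - 1) = ?w ! (i - 1)"
    using prefix_iter_word_Suc[of i] length_iter_word[of i] by (auto simp: prefix_def nth_append)
  then have "take (Suc (Suc (i - 1))) ?w = take (i - 1) ?w @ [False, False]"
    using f len assms by (cases i) (simp_all add: take_Suc_conv_app_nth)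
  then have "prefix (take (i - 1) ?w @ [False, False]) (image_word (iter_word i))"
    by (metis take_is_prefix iter_word_Suc)
  then show False using no_double_False_image_word by blast
qed

lemma box_mono:
  assumes "0 < i" "i \<le> j"
  shows "box i \<le> box j"
  using assms(2)
proof (induction j rule: dec_induct)
  case (step j)
  then show ?case using box_Suc[of j] assms(1) by simp
qed simp

text \<open>Labels rise by at most 1 per ball and strictly over two balls, so none is
  skipped.\<close>

lemma box_attains: "\<exists>i>0. box i = Suc n"
proof (induction n)
  case 0
  show ?case using box_1 by (intro exI[of _ 1]) simp
next
  case (Suc n)
  then obtain i where i: "0 < i" "box i = Suc n" by blast
  have "box (Suc i) = Suc (Suc n) \<or> box (Suc (Suc i)) = Suc (Suc n)"
    using i box_Suc[of i] box_Suc[of "Suc i"] box_Suc_Suc[of i] by (auto split: if_splits)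
  then show ?case by blast
qed

text \<open>From the least ball \<open>m\<close> of the box, monotonicity and the strict rise by
  ball \<open>m + 2\<close> leave only \<open>m\<close> and its successor.\<close>

lemma box_fibre_subset: "\<exists>m. {b. 0 < b \<and> box b = i} \<subseteq> {m, Suc m}"
proof (cases "\<exists>b. 0 < b \<and> box b = i")
  case True
  define m where "m = (LEAST b. 0 < b \<and> box b = i)"
  have m: "0 < m" "box m = i" using LeastI_ex[OF True] by (auto simp: m_def)
  have "b = m \<or> b = Suc m" if "0 < b" "box b = i" for b
  proof -
    have "m \<le> b" unfolding m_def using that by (simp add: Least_le)
    moreover have "\<not> Suc (Suc m) \<le> b"
      using box_mono[of "Suc (Suc m)" b] box_Suc_Suc[OF m(1)] m that by auto
    ultimately show ?thesis by linarith
  qed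
  then show ?thesis by blast
qed blast

lemma ball_box_distribution_box: "ball_box_distribution 2 box"
  unfolding ball_box_distribution_def
proof (intro conjI allI impI)
  show "box ` {0<..} = {0<..}"
  proof
    show "box ` {0<..} \<subseteq> {0<..}" by (auto simp: box_def)
    show "{0<..} \<subseteq> box ` {0<..}"
    proof
      fix n :: nat assume "n \<in> {0<..}"
      then obtain i where "0 < i" "box i = n" using box_attains[of "n - 1"] by auto
      then show "n \<in> box ` {0<..}" by auto
    qed
  qed
  fix i :: nat assume "0 < i"
  then show "{b. 0 < b \<and> box b = i} \<noteq> {}" using box_attains[of "i - 1"] by auto
  obtain m where m: "{b. 0 < b \<and> box b = i} \<subseteq> {m, Suc m}" using box_fibre_subset by blast
  then show "finite {b. 0 < b \<and> box b = i}" by (rule finite_subset) simp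
  have "card {b. 0 < b \<and> box b = i} \<le> card {m, Suc m}" using m by (intro card_mono) auto
  then show "card {b. 0 < b \<and> box b = i} \<le> 2" by simp
  show "box i \<le> box (i + 1)" using box_mono[of i "i + 1"] \<open>0 < i\<close> by simp
qed simp

section \<open>Box progressions as progressions of letter counts\<close>

lemma arith_prog_closed_form:
  assumes "arith_prog k s d" "j < k"
  shows "int (s (Suc j)) = int (s 1) + int j * d"
  using assms(2)
proof (induction j)
  case (Suc j)
  have "\<forall>i\<in>{1..<k}. int (s (i + 1)) - int (s i) = d"
    using assms(1) unfolding arith_prog_def .
  moreover have "Suc j \<in> {1..<k}" using Suc.prems by simp
  ultimately have "int (s (Suc j + 1)) - int (s (Suc j)) = d" by (rule bspec)
  then show ?case using Suc by (simp add: algebra_simps)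
qed simp

text \<open>The prefix before ball \<open>b\<close> has \<open>b - box b\<close> 0s and
  \<open>box b - 1\<close> 1s, so differences \<open>d\<close> and \<open>e\<close> become
  \<open>d - e\<close> and \<open>e\<close> for the counts.\<close>

lemma no_box_progression_6_box: "\<not> box_progression box 6 h"
proof
  assume "box_progression box 6 h"
  then obtain d e where pos: "\<forall>i\<in>{1..6}. 0 < h i" and "d \<noteq> 0"
    and h: "arith_prog 6 h d" and b: "arith_prog 6 (\<lambda>i. box (h i)) e"
    unfolding box_progression_def by blast
  \<comment> \<open>Large enough for all six prefixes to lie in one iterate.\<close>
  define k where "k = Max (h ` {1..6})"
  let ?x = "int (h 1) - int (box (h 1))" and ?y = "int (box (h 1)) - 1"
  have "prefix_counts (iter_word k) (?x + j * (d - e)) (?y + j * e)" if "j \<in> {0..5}" for j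
  proof -
    define i where "i = Suc (nat j)"
    have i: "i \<in> {1..6}" "int (nat j) = j" "nat j < 6" using that by (auto simp: i_def)
    have hk: "h i \<le> k" using i unfolding k_def by (intro Max_ge) auto
    define p where "p = take (h i - 1) (iter_word k)"
    have "length p = h i - 1" using hk length_iter_word[of k] by (simp add: p_def)
    then have len: "int (length p) = int (h i) - 1" using pos i(1) by force
    have one: "int (count_list p True) = int (box (h i)) - 1"
      using box_eq[of "h i" k] hk by (simp add: p_def)
    have "int (count_list p False) = int (h i) - int (box (h i))"
      using len one length_eq_count_list[of p] by simp
    moreover have "int (h i) = int (h 1) + j * d" "int (box (h i)) = int (box (h 1)) + j * e"
      using arith_prog_closed_form[OF h i(3)] arith_prog_closed_form[OF b i(3)] i(2)
      by (simp_all add: i_def)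
    moreover have "prefix p (iter_word k)" by (simp add: p_def take_is_prefix)
    ultimately show ?thesis
      unfolding prefix_counts_def using one by (intro exI[of _ p]) (simp add: algebra_simps)
  qed
  then have "d - e = 0 \<and> e = 0"
    using no_count_progression_iter_word[of k] unfolding no_count_progression_def by blast
  then show False using \<open>d \<noteq> 0\<close> by simp
qed

theorem corollary5p2:
  "\<exists>D :: nat \<Rightarrow> nat. ball_box_distribution 2 D \<and> \<not> (\<exists>h. box_progression D 6 h)"
  using ball_box_distribution_box no_box_progression_6_box by blast

end
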